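(* For every $\epsilon>0$ there exists $M(\epsilon)$ such that for all real $x\ge M(\epsilon)$, \[ \pi(x) > \frac{\dfrac{x}{1+e^{-2+\epsilon}}}{W\!\left(\dfrac{x}{1+e^{-2+\epsilon}}\right)} - 1 . \]
   Context: $\pi(x)$ denotes the number of primes $\le x$. $W=W_0$ denotes the principal real branch of the Lambert $W$ function, i.e. the unique real solution $w\ge -1$ of $w e^{w}=y$ for $y\ge -1/e$. *)

theory Defs
  imports Complex_Main "HOL-Computational_Algebra.Primes"
begin

definition prime_pi :: "real \<Rightarrow> nat" where
  "prime_pi x = card {p :: nat. prime p \<and> real p \<le> x}"

text \<open>Principal real branch; the value is only meaningful for \<open>y \<ge> -1/e\<close>.\<close>

definition Lambert_W :: "real \<Rightarrow> real" where
  "Lambert_W y = (THE w. w \<ge> -1 \<and> w * exp w = y)"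

end

theory Submission
  imports Defs "HOL-Number_Theory.Prime_Powers" "HOL-Analysis.Complex_Transcendental"
    "HOL-Real_Asymp.Real_Asymp"
begin

text \<open>
  Since \<open>y / W(y) \<sim> y / ln y\<close>, the claim follows from any bound
  \<open>\<pi>(x) \<ge> (a - o(1)) x / ln x\<close> with \<open>a > 1 / (1 + exp (-2)) = 0.8808\<dots>\<close>. Chebyshev's bound
  suffices: the factorial ratio \<open>(30k)! k! / ((15k)! (10k)! (6k)!)\<close> has logarithm
  \<open>\<Sum>d. \<Lambda>(d) (\<lfloor>30k/d\<rfloor> - \<lfloor>15k/d\<rfloor> - \<lfloor>10k/d\<rfloor> - \<lfloor>6k/d\<rfloor> + \<lfloor>k/d\<rfloor>)\<close>, in which every bracket is
  at most 1, so it is bounded by \<open>\<psi>(30k) \<le> \<pi>(30k) ln (30k)\<close>; by Stirling's formula it is also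
  \<open>(14 ln 2 + 9 ln 3 + 5 ln 5) k + O(ln k)\<close>, which gives \<open>a = 0.921\<dots>\<close>. We only use \<open>a = 0.9\<close>.
\<close>

section \<open>Stirling bounds for the logarithm of a factorial\<close>

text \<open>The induction step amounts to \<open>n * ln ((n + 1) / n) \<le> 1\<close>; in the upper
  bound below it is \<open>(n + 1) * ln ((n + 1) / n) \<ge> 1\<close>. The two bounds differ by
  \<open>ln n\<close> only.\<close>

lemma ln_fact_lower:
  assumes "n > 0"
  shows "real n * ln (real n) - real n + 1 \<le> ln (fact n)"
  using assms
proof (induction n rule: nat_induct_non_zero)
  case 1
  then show ?case by simp
next
  case (Suc n)
  have "ln (1 + 1 / real n) \<le> 1 / real n"
    using Suc.hyps by (intro ln_add_one_self_le_self) simp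
  also have "1 + 1 / real n = real (Suc n) / real n"
    using Suc.hyps by (simp add: field_simps)
  finally have "ln (real (Suc n)) - ln (real n) \<le> 1 / real n"
    using Suc.hyps by (simp add: ln_div)
  then have "real n * (ln (real (Suc n)) - ln (real n)) \<le> 1"
    using Suc.hyps by (simp add: field_simps)
  moreover have "ln (fact (Suc n)) = ln (real (Suc n)) + ln (fact n :: real)"
    unfolding fact_Suc using Suc.hyps by (subst ln_mult) auto
  ultimately show ?case
    using Suc.IH by (simp add: algebra_simps)
qed

lemma ln_fact_upper:
  assumes "n > 0"
  shows "ln (fact n) \<le> real n * ln (real n) - real n + 1 + ln (real n)"
  using assms
proof (induction n rule: nat_induct_non_zero)
  case 1
  then show ?case by simp
next
  case (Suc n)
  have "ln (real n / real (Suc n)) \<le> real n / real (Suc n) - 1"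
    using Suc.hyps by (intro ln_le_minus_one) simp
  also have "\<dots> = - 1 / real (Suc n)"
    by (simp add: field_simps)
  finally have "ln (real (Suc n)) - ln (real n) \<ge> 1 / real (Suc n)"
    using Suc.hyps by (simp add: ln_div)
  then have "real (Suc n) * (ln (real (Suc n)) - ln (real n)) \<ge> 1"
    by (simp add: field_simps)
  moreover have "ln (fact (Suc n)) = ln (real (Suc n)) + ln (fact n :: real)"
    unfolding fact_Suc using Suc.hyps by (subst ln_mult) auto
  ultimately show ?case
    using Suc.IH by (simp add: algebra_simps)
qed

section \<open>Factorials and the von Mangoldt function\<close>

lemma card_multiples:
  assumes "d > 0"
  shows "card {m \<in> {1..n}. d dvd m} = n div d"
proof -
  have "{m \<in> {1..n}. d dvd m} = (\<lambda>j. d * j) ` {1..n div d}"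
  proof (intro equalityI subsetI)
    fix m assume "m \<in> {m \<in> {1..n}. d dvd m}"
    then obtain j where "m = d * j" "m \<ge> 1" "m \<le> n" by auto
    then show "m \<in> (\<lambda>j. d * j) ` {1..n div d}"
      using assms by (auto simp: less_eq_div_iff_mult_less_eq mult.commute intro!: imageI)
  next
    fix m assume "m \<in> (\<lambda>j. d * j) ` {1..n div d}"
    then show "m \<in> {m \<in> {1..n}. d dvd m}"
      using assms by (auto simp: less_eq_div_iff_mult_less_eq mult.commute)
  qed
  moreover have "inj_on (\<lambda>j. d * j) {1..n div d}"
    using assms by (auto intro: inj_onI)
  ultimately show ?thesis
    by (simp add: card_image)
qed

text \<open>Sum \<open>ln m = (\<Sum>d | d dvd m. mangoldt d)\<close> over \<open>m\<close> and swap
  the sums. Terms with \<open>d > n\<close> vanish, so a common \<open>N\<close> lets factorials of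
  different arguments be combined term by term.\<close>

lemma ln_fact_conv_mangoldt:
  assumes "n \<le> N"
  shows "ln (fact n) = (\<Sum>d=1..N. mangoldt d * real (n div d))"
proof -
  have "ln (fact n) = (\<Sum>m=1..n. ln (real m))"
    unfolding fact_prod of_nat_prod by (subst ln_prod) auto
  also have "\<dots> = (\<Sum>m=1..n. \<Sum>d | d dvd m. mangoldt d)"
    by (intro sum.cong) (auto simp: mangoldt_sum)
  also have "\<dots> = (\<Sum>m=1..n. \<Sum>d | d \<in> {1..N} \<and> d dvd m. mangoldt d)"
  proof (rule sum.cong[OF refl], rule sum.cong[OF _ refl])
    fix m assume "m \<in> {1..n}"
    then show "{d. d dvd m} = {d. d \<in> {1..N} \<and> d dvd m}"
      using assms by (auto dest: dvd_imp_le dvd_pos_nat simp: Suc_le_eq intro: Nat.gr0I order.trans)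
  qed
  also have "\<dots> = (\<Sum>d=1..N. \<Sum>m | m \<in> {1..n} \<and> d dvd m. mangoldt d)"
    by (rule sum.swap_restrict) auto
  also have "\<dots> = (\<Sum>d=1..N. mangoldt d * real (n div d))"
  proof (rule sum.cong[OF refl])
    fix d assume "d \<in> {1..N}"
    then have "card {m \<in> {1..n}. d dvd m} = n div d"
      by (intro card_multiples) simp
    then show "(\<Sum>m | m \<in> {1..n} \<and> d dvd m. mangoldt d) = mangoldt d * real (n div d)"
      by simp
  qed
  finally show ?thesis .
qed

section \<open>Chebyshev's integer inequality\<close>

text \<open>Since 30 + 1 = 15 + 10 + 6, the multiples of 30 in \<open>a\<close> cancel, and the
  residues \<open>r < 30\<close> are checked one by one.\<close>

lemma chebyshev_bracket_le_1:
  "a + a div 30 \<le> 1 + a div 2 + a div 3 + a div (5::nat)"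
proof -
  define q r where "q = a div 30" and "r = a mod 30"
  have a: "a = r + 30 * q" by (simp add: q_def r_def)
  have "a div 2 = r div 2 + 15 * q" "a div 3 = r div 3 + 10 * q" "a div 5 = r div 5 + 6 * q"
    unfolding a by linarith+
  moreover have "r \<in> {..<30}" by (simp add: r_def)
  then have "r \<le> 1 + r div 2 + r div 3 + r div 5"
    by (auto simp: lessThan_nat_numeral lessThan_Suc)
  ultimately show ?thesis
    unfolding q_def[symmetric] using a by linarith
qed

lemma chebyshev_bracket_div_le_1:
  fixes k d :: nat
  shows "real (30 * k div d) + real (k div d) - real (15 * k div d) - real (10 * k div d)
           - real (6 * k div d) \<le> 1"
proof -
  \<comment> \<open>Nested floors collapse, so every quotient is a function of the single number
    \<open>a = 30 * k div d\<close>.\<close>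
  have scale: "b * k div d = 30 * k div d div c" if "b * c = 30" "c > 0" for b c :: nat
  proof -
    have "30 * k div d div c = c * (b * k) div (c * d)"
      using that by (metis div_mult2_eq mult.assoc mult.commute)
    then show ?thesis using that by simp
  qed
  have "15 * k div d = 30 * k div d div 2" "10 * k div d = 30 * k div d div 3"
    "6 * k div d = 30 * k div d div 5" "k div d = 30 * k div d div 30"
    using scale[of 15 2] scale[of 10 3] scale[of 6 5] scale[of 1 30] by simp_all
  with chebyshev_bracket_le_1[of "30 * k div d"]
  have "30 * k div d + k div d \<le> 1 + 15 * k div d + 10 * k div d + 6 * k div d"
    by simp
  then show ?thesis by linarith
qed

section \<open>From \<psi> to the prime counting function\<close>

lemma finite_primes_le_real: "finite {p :: nat. prime p \<and> real p \<le> x}"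
proof (rule finite_subset)
  show "{p :: nat. prime p \<and> real p \<le> x} \<subseteq> {..nat \<lfloor>x\<rfloor>}"
    by (auto simp: le_nat_floor)
qed auto

lemma prime_pi_mono: "x \<le> y \<Longrightarrow> prime_pi x \<le> prime_pi y"
  unfolding prime_pi_def by (intro card_mono finite_primes_le_real) auto

text \<open>Group the prime powers up to \<open>n\<close> by their prime \<open>p\<close>: there are
  at most \<open>log p n\<close> of them, each contributing \<open>ln p\<close>, hence at most
  \<open>ln n\<close> per prime.\<close>

lemma sum_mangoldt_le:
  assumes "n > 0"
  shows "(\<Sum>d=1..n. mangoldt d) \<le> real (prime_pi (real n)) * ln (real n)"
proof -
  let ?P = "{p :: nat. prime p \<and> real p \<le> real n}"
  let ?Q = "{d \<in> {1..n}. primepow d}"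
  have "(\<Sum>d=1..n. mangoldt d :: real) = (\<Sum>d\<in>?Q. mangoldt d)"
    by (intro sum.mono_neutral_right) (auto simp: mangoldt_def)
  also have "\<dots> = (\<Sum>p\<in>?P. \<Sum>d | d \<in> ?Q \<and> aprimedivisor d = p. mangoldt d)"
  proof (rule sum.group[symmetric])
    show "aprimedivisor ` ?Q \<subseteq> ?P"
      using primepow_gt_Suc_0
      by (auto dest!: primepow_gt_Suc_0 intro!: aprimedivisor_nat(1)
               intro: order.trans[OF aprimedivisor_le_nat])
  qed (use finite_primes_le_real in auto)
  also have "\<dots> \<le> (\<Sum>p\<in>?P. ln (real n))"
  proof (rule sum_mono)
    fix p assume "p \<in> ?P"
    then have p: "prime p" by simp
    then have p1: "real p > 1" using prime_gt_1_nat by simp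
    let ?S = "{d. d \<in> ?Q \<and> aprimedivisor d = p}"
    let ?L = "nat \<lfloor>log (real p) (real n)\<rfloor>"
    have "?S \<subseteq> (\<lambda>k. p ^ k) ` {1..?L}"
    proof
      fix d assume "d \<in> ?S"
      then obtain k where k: "k > 0" "d = p ^ k" "d \<le> n"
        by (auto simp: primepow_def aprimedivisor_prime_power)
      then have "real p ^ k \<le> real n"
        by (metis of_nat_le_iff of_nat_power)
      then have "real k \<le> log (real p) (real n)"
        using p1 by (intro le_log_of_power)
      then have "k \<le> ?L" by (rule le_nat_floor)
      with k show "d \<in> (\<lambda>k. p ^ k) ` {1..?L}" by auto
    qed
    then have "card ?S \<le> card {1..?L}"
      by (intro surj_card_le) auto
    then have "real (card ?S) \<le> real ?L" by simp
    also have "\<dots> \<le> log (real p) (real n)"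
      using p1 assms by (intro of_nat_floor) simp
    finally have card: "real (card ?S) \<le> log (real p) (real n)" .
    have "(\<Sum>d\<in>?S. mangoldt d :: real) = (\<Sum>d\<in>?S. ln (real p))"
      by (intro sum.cong) (auto simp: mangoldt_def)
    also have "\<dots> = real (card ?S) * ln (real p)" by simp
    also have "\<dots> \<le> log (real p) (real n) * ln (real p)"
      using card p1 by (intro mult_right_mono) auto
    also have "\<dots> = ln (real n)"
      using p1 by (simp add: log_def)
    finally show "(\<Sum>d\<in>?S. mangoldt d) \<le> ln (real n)" .
  qed
  also have "\<dots> = real (prime_pi (real n)) * ln (real n)"
    by (simp add: prime_pi_def)
  finally show ?thesis .
qed

section \<open>Chebyshev's lower bound\<close>

text \<open>The target is 27 = 0.9 * 30. After exponentiating, e < 2.72 leaves enough room.\<close>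

lemma chebyshev_constant_gt: "14 * ln 2 + 9 * ln 3 + 5 * ln 5 > (27 :: real)"
proof -
  have "exp (27 :: real) = exp 1 ^ 27"
    by (simp flip: exp_of_nat_mult)
  also have "\<dots> \<le> (272 / 100) ^ 27"
    using e_less_272 by (intro power_mono) auto
  also have "\<dots> < 2 ^ 14 * 3 ^ 9 * (5 :: real) ^ 5"
    by (simp add: power_divide divide_simps)
  finally have "27 < ln (2 ^ 14 * 3 ^ 9 * (5 :: real) ^ 5)"
    by (subst ln_exp[symmetric], intro ln_less_cancel_iff[THEN iffD2]) auto
  also have "\<dots> = 14 * ln 2 + 9 * ln 3 + 5 * ln 5"
    by (simp only: ln_mult ln_realpow) (simp add: ln_mult ln_realpow)
  finally show ?thesis .
qed

lemma prime_pi_30_lower: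
  assumes "k > 0"
  shows "real (prime_pi (real (30 * k))) * ln (real (30 * k))
           \<ge> 27 * real k - 3 * ln (real (30 * k)) - 1"
proof -
  let ?D = "ln (fact (30 * k)) + ln (fact k) - ln (fact (15 * k)) - ln (fact (10 * k))
              - ln (fact (6 * k)) :: real"
  have "?D = (\<Sum>d=1..30 * k. mangoldt d * (real (30 * k div d) + real (k div d)
                - real (15 * k div d) - real (10 * k div d) - real (6 * k div d)))"
    by (simp add: ln_fact_conv_mangoldt[where N = "30 * k"] ring_distribs
                  sum.distrib sum_subtractf)
  also have "\<dots> \<le> (\<Sum>d=1..30 * k. mangoldt d)"
    by (intro sum_mono mult_left_le chebyshev_bracket_div_le_1 mangoldt_nonneg)
  also have "\<dots> \<le> real (prime_pi (real (30 * k))) * ln (real (30 * k))"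
    using assms by (intro sum_mangoldt_le) simp
  finally have upper: "?D \<le> real (prime_pi (real (30 * k))) * ln (real (30 * k))" .

  define l where "l = ln (real k)"
  have l: "ln (real (c * k)) = ln (real c) + l" if "c > 0" for c :: nat
    using that assms by (simp add: l_def ln_mult)
  have lower: "ln (fact (c * k)) \<ge> real (c * k) * (ln (real c) + l) - real (c * k) + 1"
    if "c > 0" for c
    using ln_fact_lower[of "c * k"] that assms by (simp add: l del: of_nat_mult)
  have upper': "ln (fact (c * k)) \<le> real (c * k) * (ln (real c) + l) - real (c * k) + 1
                  + ln (real c) + l"
    if "c > 0" for c
    using ln_fact_upper[of "c * k"] that assms by (simp add: l del: of_nat_mult)
  have lns: "ln (30 :: real) = ln 2 + ln 3 + ln 5" "ln (15 :: real) = ln 3 + ln 5"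
    "ln (10 :: real) = ln 2 + ln 5" "ln (6 :: real) = ln 2 + ln 3"
    using ln_mult[of 2 3] ln_mult[of 6 5] ln_mult[of 3 5] ln_mult[of 2 "5::real"] by simp_all
  have pos: "ln (2 :: real) > 0" "ln (3 :: real) > 0" "ln (5 :: real) > 0"
    by simp_all
  have "(14 * ln 2 + 9 * ln 3 + 5 * ln 5) * real k \<ge> 27 * real k"
    using chebyshev_constant_gt by (intro mult_right_mono) auto
  \<comment> \<open>The terms in \<open>k * l\<close> and the linear terms \<open>- c * k\<close>
    cancel because 30 + 1 = 15 + 10 + 6. The three upper bounds cost \<open>ln 900 + 3 * l\<close>,
    which is at most \<open>3 * ln (30 * k)\<close>; the constants leave 2 - 3 = -1.\<close>
  then have "?D \<ge> 27 * real k - 3 * ln (real (30 * k)) - 1"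
    using lower[of 30] lower[of 1] upper'[of 15] upper'[of 10] upper'[of 6] l[of 30]
    by (simp add: lns algebra_simps) (use pos in linarith)
  with upper show ?thesis by linarith
qed

theorem prime_pi_lower:
  assumes "x \<ge> 30"
  shows "real (prime_pi x) * ln x \<ge> 9 / 10 * x - 3 * ln x - 28"
proof -
  define k where "k = nat \<lfloor>x / 30\<rfloor>"
  have "\<lfloor>x / 30\<rfloor> \<ge> 1" using assms by simp
  then have k0: "k > 0" by (simp add: k_def)
  have "real k = of_int \<lfloor>x / 30\<rfloor>"
    using \<open>\<lfloor>x / 30\<rfloor> \<ge> 1\<close> by (simp add: k_def)
  then have k: "real (30 * k) \<le> x" "30 * real k \<ge> x - 30"
    by simp_all linarith+
  have lnk: "0 \<le> ln (real (30 * k))" "ln (real (30 * k)) \<le> ln x"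
    using k0 k by (auto intro!: ln_ge_zero ln_mono simp del: of_nat_mult)
  \<comment> \<open>Rounding \<open>x\<close> down to a multiple of 30 costs at most 0.9 * 30 = 27,
    whence 28 = 27 + 1.\<close>
  have "9 / 10 * x - 3 * ln x - 28 \<le> 27 * real k - 3 * ln (real (30 * k)) - 1"
    using k lnk by simp
  also have "\<dots> \<le> real (prime_pi (real (30 * k))) * ln (real (30 * k))"
    using k0 by (rule prime_pi_30_lower)
  also have "\<dots> \<le> real (prime_pi x) * ln x"
    using prime_pi_mono[OF k(1)] lnk by (intro mult_mono) auto
  finally show ?thesis .
qed

section \<open>The Lambert function and the final comparison\<close>

text \<open>The intermediate value theorem gives a root in \<open>[v, v + y]\<close>. As
  \<open>y > 0\<close>, any root is nonnegative, where \<open>w * exp w\<close> is strictly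
  increasing; so this root is the value selected by \<open>THE\<close>.\<close>

lemma Lambert_W_ge:
  assumes "v \<ge> 0" "v * exp v \<le> y" "y > 0"
  shows "Lambert_W y \<ge> v"
proof -
  have mono: "a * exp a < b * exp b" if "0 \<le> a" "a < b" for a b :: real
    using that by (intro mult_strict_mono) auto
  have "\<exists>w\<ge>v. w \<le> v + y \<and> w * exp w = y"
  proof (rule IVT')
    have "y * 1 \<le> (v + y) * exp (v + y)"
      using assms by (intro mult_mono) auto
    then show "y \<le> (v + y) * exp (v + y)" by simp
  qed (use assms in \<open>auto intro!: continuous_intros\<close>)
  then obtain w where w: "w \<ge> v" "w * exp w = y" by blast
  have "Lambert_W y = w"
    unfolding Lambert_W_def
  proof (rule the_equality)
    fix u assume u: "- 1 \<le> u \<and> u * exp u = y"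
    then have "u \<ge> 0" using assms(3) by (metis exp_gt_zero less_eq_real_def zero_less_mult_pos2)
    then show "u = w"
      using mono[of u w] mono[of w u] u w assms(1) by (cases u w rule: linorder_cases) auto
  qed (use w assms in auto)
  with w show ?thesis by simp
qed

theorem theorem4:
  fixes \<epsilon> :: real
  assumes "\<epsilon> > 0"
  shows "\<exists>M :: real. \<forall>x :: real. x \<ge> M \<longrightarrow>
           real (prime_pi x) >
             (x / (1 + exp (-2 + \<epsilon>))) / Lambert_W (x / (1 + exp (-2 + \<epsilon>))) - 1"
proof -
  define c where "c = 1 + exp (- 2 + \<epsilon>)"
  \<comment> \<open>The smallest \<open>c\<close> is approached as \<epsilon> tends to 0, so
    \<open>exp 2 \<le> 8\<close> gives \<open>c \<ge> 9 / 8\<close> for every \<epsilon>.\<close>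
  have "exp (2 :: real) = exp 1 * exp 1"
    by (simp flip: exp_add)
  also have "\<dots> \<le> 272 / 100 * (272 / 100)"
    using e_less_272 by (intro mult_mono) auto
  finally have "exp (- 2 :: real) \<ge> 1 / 8"
    by (simp add: exp_minus field_simps)
  moreover have "exp (- 2 :: real) \<le> exp (- 2 + \<epsilon>)"
    using assms by simp
  ultimately have c: "c \<ge> 9 / 8" unfolding c_def by linarith
  then have c0: "c > 0" by simp
  \<comment> \<open>\<open>1 / c \<le> 8 / 9 < 0.9 * 0.99\<close>, so a loss of one per cent in \<open>W (x / c) \<sim> ln x\<close> is affordable.\<close>
  have "eventually (\<lambda>x. 99 / 100 * ln x * exp (99 / 100 * ln x) \<le> x / c) at_top"
    using c0 by real_asymp
  \<comment> \<open>Here 800 / 891 = (8 / 9) / (99 / 100) < 0.9, so the linear gap absorbs the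
    lower-order terms.\<close>
  moreover have "eventually (\<lambda>x :: real. 800 / 891 * x < 9 / 10 * x - 3 * ln x - 28) at_top"
    by real_asymp
  ultimately have "eventually (\<lambda>x. x / c / Lambert_W (x / c) - 1 < real (prime_pi x)) at_top"
    using eventually_ge_at_top[of 30]
  proof eventually_elim
    case (elim x)
    have lnx: "ln x > 0" using elim by simp
    have W: "Lambert_W (x / c) \<ge> 99 / 100 * ln x"
      using elim lnx c0 by (intro Lambert_W_ge) auto
    have "x / c / Lambert_W (x / c) \<le> (x / (9 / 8)) / (99 / 100 * ln x)"
      using elim lnx c W by (intro frac_le divide_left_mono) auto
    also have "\<dots> = 800 / 891 * x / ln x"
      by simp
    also have "\<dots> < (9 / 10 * x - 3 * ln x - 28) / ln x"
      using elim lnx by (intro divide_strict_right_mono) auto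
    also have "\<dots> \<le> real (prime_pi x)"
      using prime_pi_lower[OF elim(3)] lnx by (simp add: pos_divide_le_eq)
    finally show ?case by simp
  qed
  then show ?thesis
    by (simp add: eventually_at_top_linorder c_def)
qed

end
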